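(* Let $(M,g,\eta,\nabla)$ be a semi-Weyl manifold admitting torsion (SWMT), let $M'$ be a pseudo-Riemannian (non-degenerate) hypersurface of $M$ with the induced structure, let $\phi,\psi$ be smooth functions on $M$, and let $$\widetilde g=e^{\phi+\psi}g,\qquad \widetilde\nabla_XY=\nabla_XY+d\phi(X)Y+d\phi(Y)X-g(X,Y)\,\mathrm{grad}_g\psi .$$ Then the umbilical points of $M'$ are preserved by this conformal-projective change: if $x\in M'$ is an umbilical point of $M'$ in $(M,g,\eta,\nabla)$, then $x$ is an umbilical point of $M'$ in $(M,\widetilde g,\eta,\widetilde\nabla)$.
   Context: For an affine connection $\nabla$ (possibly with torsion) on a pseudo-Riemannian manifold $(M,g)$ and a $1$-form $\eta$, put $T^\nabla(X,Y)=\nabla_XY-\nabla_YX-[X,Y]$. $(M,g,\eta,\nabla)$ is a SWMT if $(\nabla_Xg)(Y,Z)+\eta(X)g(Y,Z)=(\nabla_Yg)(X,Z)+\eta(Y)g(X,Z)-g(T^\nabla(X,Y),Z)$ for all vector fields $X,Y,Z$. A hypersurface $M'$ is pseudo-Riemannian (non-degenerate) if $g'=g|_{TM'\times TM'}$ is a pseudo-Riemannian metric. Let $N$ be the unit normal vector field of $M'$ with respect to $g$, $g(N,N)=\epsilon=\pm1$, and define on $M'$ the $(0,2)$-tensor $\beta(X,Y):=-g(\nabla_XN,Y)$ for $X,Y\in\Gamma^\infty(TM')$. A point $x\in M'$ is an umbilical point of $M'$ in $(M,g,\eta,\nabla)$ if there is a real constant $c$ with $\beta_x=c\,g'_x$.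 For $(M,\widetilde g,\eta,\widetilde\nabla)$ the same definition is used with $\widetilde g,\widetilde\nabla$, the induced metric $\widetilde g'$, and the $\widetilde g$-unit normal $\widetilde N=e^{-\frac{\phi+\psi}{2}}N$. *)

theory Defs
  imports "HOL-Analysis.Analysis"
begin

section \<open>Smooth manifolds\<close>

text \<open>Only used for open \<open>S\<close>: \<open>f\<close> has continuous iterated partial derivatives up to order \<open>k\<close> on \<open>S\<close>.\<close>

primrec Ck_on :: "nat \<Rightarrow> 'e::euclidean_space set \<Rightarrow> ('e \<Rightarrow> 'b::real_normed_vector) \<Rightarrow> bool" where
  "Ck_on 0 S f \<longleftrightarrow> continuous_on S f"
| "Ck_on (Suc k) S f \<longleftrightarrow>
     (\<forall>x\<in>S. f differentiable (at x)) \<and>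
     (\<forall>b\<in>Basis. Ck_on k S (\<lambda>x. frechet_derivative f (at x) b))"

definition smooth_on :: "'e::euclidean_space set \<Rightarrow> ('e \<Rightarrow> 'b::real_normed_vector) \<Rightarrow> bool" where
  "smooth_on S f \<longleftrightarrow> (\<forall>k. Ck_on k S f)"

text \<open>
  The points of the manifold \<open>M\<close> are the elements of a Hausdorff, second countable type \<open>'m\<close>;
  the model space is \<open>'e\<close>, so \<open>dim M = DIM('e)\<close>. A chart is a pair of its domain and a
  coordinate map; the values of the map outside the domain are irrelevant.
\<close>

type_synonym ('m, 'e) chart = "'m set \<times> ('m \<Rightarrow> 'e)"

definition is_chart :: "('m::topological_space, 'e::euclidean_space) chart \<Rightarrow> bool" where
  "is_chart = (\<lambda>(U, c). open U \<and> open (c ` U) \<and> homeomorphism U (c ` U) c (inv_into U c))"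

definition compatible ::
    "('m::topological_space, 'e::euclidean_space) chart \<Rightarrow> ('m, 'e) chart \<Rightarrow> bool" where
  "compatible = (\<lambda>(U, c) (V, d).
     smooth_on (c ` (U \<inter> V)) (d \<circ> inv_into U c) \<and>
     smooth_on (d ` (U \<inter> V)) (c \<circ> inv_into V d))"

definition smooth_structure ::
    "('m::{t2_space, second_countable_topology}, 'e::euclidean_space) chart set \<Rightarrow> bool" where
  "smooth_structure A \<longleftrightarrow>
     (\<forall>k\<in>A. is_chart k) \<and>
     (\<Union>k\<in>A. fst k) = UNIV \<and>
     (\<forall>k\<in>A. \<forall>l\<in>A. compatible k l) \<and>
     (\<forall>k. is_chart k \<and> (\<forall>l\<in>A. compatible k l) \<longrightarrow> k \<in> A)"

definition smooth_funs ::
    "('m::topological_space, 'e::euclidean_space) chart set \<Rightarrow> ('m \<Rightarrow> real) set" where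
  "smooth_funs A = {f. \<forall>(U, c)\<in>A. smooth_on (c ` U) (f \<circ> inv_into U c)}"


section \<open>Tangent vectors and vector fields\<close>

type_synonym 'm tvec = "('m \<Rightarrow> real) \<Rightarrow> real"
type_synonym 'm vfield = "'m \<Rightarrow> 'm tvec"

text \<open>
  A tangent vector at \<open>p\<close> is a derivation at \<open>p\<close> of the algebra of smooth functions. It is set to
  \<open>0\<close> on functions that are not smooth, so that equality of tangent vectors is equality in HOL.
\<close>

definition tangent_space ::
    "('m::topological_space, 'e::euclidean_space) chart set \<Rightarrow> 'm \<Rightarrow> 'm tvec set" where
  "tangent_space A p = {v.
     (\<forall>f. f \<notin> smooth_funs A \<longrightarrow> v f = 0) \<and>
     (\<forall>f\<in>smooth_funs A. \<forall>h\<in>smooth_funs A. \<forall>a b.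
        v (\<lambda>q. a * f q + b * h q) = a * v f + b * v h) \<and>
     (\<forall>f\<in>smooth_funs A. \<forall>h\<in>smooth_funs A.
        v (\<lambda>q. f q * h q) = f p * v h + h p * v f)}"

definition tv_zero :: "'m tvec" where
  "tv_zero = (\<lambda>h. 0)"

definition tv_add :: "'m tvec \<Rightarrow> 'm tvec \<Rightarrow> 'm tvec" where
  "tv_add v w = (\<lambda>h. v h + w h)"

definition tv_scale :: "real \<Rightarrow> 'm tvec \<Rightarrow> 'm tvec" where
  "tv_scale a v = (\<lambda>h. a * v h)"

definition vector_fields ::
    "('m::topological_space, 'e::euclidean_space) chart set \<Rightarrow> 'm vfield set" where
  "vector_fields A = {X.
     (\<forall>p. X p \<in> tangent_space A p) \<and>
     (\<forall>f\<in>smooth_funs A. (\<lambda>p. X p f) \<in> smooth_funs A)}"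

definition vf_add :: "'m vfield \<Rightarrow> 'm vfield \<Rightarrow> 'm vfield" where
  "vf_add X Y = (\<lambda>p. tv_add (X p) (Y p))"

definition vf_scale :: "('m \<Rightarrow> real) \<Rightarrow> 'm vfield \<Rightarrow> 'm vfield" where
  "vf_scale f X = (\<lambda>p. tv_scale (f p) (X p))"

definition lie_bracket :: "'m vfield \<Rightarrow> 'm vfield \<Rightarrow> 'm vfield" where
  "lie_bracket X Y = (\<lambda>p f. X p (\<lambda>q. Y q f) - Y p (\<lambda>q. X q f))"


section \<open>One-forms, metrics and affine connections\<close>

definition one_form ::
    "('m::topological_space, 'e::euclidean_space) chart set \<Rightarrow> ('m \<Rightarrow> 'm tvec \<Rightarrow> real) \<Rightarrow> bool" where
  "one_form A \<eta> \<longleftrightarrow>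
     (\<forall>p. \<forall>u\<in>tangent_space A p. \<forall>v\<in>tangent_space A p. \<forall>a b.
        \<eta> p (tv_add (tv_scale a u) (tv_scale b v)) = a * \<eta> p u + b * \<eta> p v) \<and>
     (\<forall>X\<in>vector_fields A. (\<lambda>p. \<eta> p (X p)) \<in> smooth_funs A)"

type_synonym 'm tensor2 = "'m \<Rightarrow> 'm tvec \<Rightarrow> 'm tvec \<Rightarrow> real"

definition nondegenerate_on :: "'m tvec set \<Rightarrow> ('m tvec \<Rightarrow> 'm tvec \<Rightarrow> real) \<Rightarrow> bool" where
  "nondegenerate_on V B \<longleftrightarrow> (\<forall>u\<in>V. (\<forall>v\<in>V. B u v = 0) \<longrightarrow> u = tv_zero)"

definition pseudo_riemannian_metric ::
    "('m::topological_space, 'e::euclidean_space) chart set \<Rightarrow> 'm tensor2 \<Rightarrow> bool" where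
  "pseudo_riemannian_metric A g \<longleftrightarrow>
     (\<forall>p. \<forall>u\<in>tangent_space A p. \<forall>v\<in>tangent_space A p. g p u v = g p v u) \<and>
     (\<forall>p. \<forall>u\<in>tangent_space A p. \<forall>v\<in>tangent_space A p. \<forall>w\<in>tangent_space A p. \<forall>a b.
        g p (tv_add (tv_scale a u) (tv_scale b v)) w = a * g p u w + b * g p v w) \<and>
     (\<forall>p. nondegenerate_on (tangent_space A p) (g p)) \<and>
     (\<forall>X\<in>vector_fields A. \<forall>Y\<in>vector_fields A. (\<lambda>p. g p (X p) (Y p)) \<in> smooth_funs A)"

definition affine_connection ::
    "('m::topological_space, 'e::euclidean_space) chart set
       \<Rightarrow> ('m vfield \<Rightarrow> 'm vfield \<Rightarrow> 'm vfield) \<Rightarrow> bool" where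
  "affine_connection A nabla \<longleftrightarrow>
     (\<forall>X\<in>vector_fields A. \<forall>Y\<in>vector_fields A. nabla X Y \<in> vector_fields A) \<and>
     (\<forall>X\<in>vector_fields A. \<forall>X'\<in>vector_fields A. \<forall>Y\<in>vector_fields A.
        nabla (vf_add X X') Y = vf_add (nabla X Y) (nabla X' Y)) \<and>
     (\<forall>f\<in>smooth_funs A. \<forall>X\<in>vector_fields A. \<forall>Y\<in>vector_fields A.
        nabla (vf_scale f X) Y = vf_scale f (nabla X Y)) \<and>
     (\<forall>X\<in>vector_fields A. \<forall>Y\<in>vector_fields A. \<forall>Y'\<in>vector_fields A.
        nabla X (vf_add Y Y') = vf_add (nabla X Y) (nabla X Y')) \<and>
     (\<forall>f\<in>smooth_funs A. \<forall>X\<in>vector_fields A. \<forall>Y\<in>vector_fields A.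
        nabla X (vf_scale f Y) = vf_add (vf_scale f (nabla X Y)) (vf_scale (\<lambda>p. X p f) Y))"

definition torsion ::
    "('m vfield \<Rightarrow> 'm vfield \<Rightarrow> 'm vfield) \<Rightarrow> 'm vfield \<Rightarrow> 'm vfield \<Rightarrow> 'm vfield" where
  "torsion nabla X Y = (\<lambda>p h. nabla X Y p h - nabla Y X p h - lie_bracket X Y p h)"

definition cov_deriv_metric ::
    "('m vfield \<Rightarrow> 'm vfield \<Rightarrow> 'm vfield) \<Rightarrow> 'm tensor2
       \<Rightarrow> 'm vfield \<Rightarrow> 'm vfield \<Rightarrow> 'm vfield \<Rightarrow> 'm \<Rightarrow> real" where
  "cov_deriv_metric nabla g X Y Z p =
     X p (\<lambda>q. g q (Y q) (Z q)) - g p (nabla X Y p) (Z p) - g p (Y p) (nabla X Z p)"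

definition SWMT ::
    "('m::{t2_space, second_countable_topology}, 'e::euclidean_space) chart set \<Rightarrow> 'm tensor2
       \<Rightarrow> ('m \<Rightarrow> 'm tvec \<Rightarrow> real) \<Rightarrow> ('m vfield \<Rightarrow> 'm vfield \<Rightarrow> 'm vfield) \<Rightarrow> bool" where
  "SWMT A g \<eta> nabla \<longleftrightarrow>
     smooth_structure A \<and> pseudo_riemannian_metric A g \<and> one_form A \<eta> \<and> affine_connection A nabla \<and>
     (\<forall>X\<in>vector_fields A. \<forall>Y\<in>vector_fields A. \<forall>Z\<in>vector_fields A. \<forall>p.
        cov_deriv_metric nabla g X Y Z p + \<eta> p (X p) * g p (Y p) (Z p) =
        cov_deriv_metric nabla g Y X Z p + \<eta> p (Y p) * g p (X p) (Z p)
          - g p (torsion nabla X Y p) (Z p))"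


section \<open>Hypersurfaces\<close>

text \<open>
  A hypersurface \<open>M'\<close> is given by its manifold topology \<open>T\<close>, with \<open>topspace T \<subseteq> M\<close> its set of points:
  near each of its points, \<open>M'\<close> is a coordinate hyperplane slice of a chart of \<open>M\<close>. For
  \<open>T = top_of_set S\<close> this is an embedded hypersurface; a finer \<open>T\<close> allows injectively immersed ones.
\<close>

definition hypersurface ::
    "('m::topological_space, 'e::euclidean_space) chart set \<Rightarrow> 'm topology \<Rightarrow> bool" where
  "hypersurface A T \<longleftrightarrow>
     second_countable T \<and>
     (\<forall>x\<in>topspace T. \<exists>(U, c)\<in>A. \<exists>b\<in>Basis. x \<in> U \<and>
        openin T {p\<in>U. c p \<bullet> b = 0} \<and>
        subtopology T {p\<in>U. c p \<bullet> b = 0} = top_of_set {p\<in>U. c p \<bullet> b = 0})"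

text \<open>
  The tangent space of \<open>M'\<close> at \<open>x\<close> as a subspace of the tangent space of \<open>M\<close>: the vectors that
  annihilate every smooth function vanishing on \<open>M'\<close> near \<open>x\<close>. In a slice chart as above these are
  the vectors whose \<open>b\<close>-component is \<open>0\<close>.
\<close>

definition tangent_subspace ::
    "('m::topological_space, 'e::euclidean_space) chart set \<Rightarrow> 'm topology \<Rightarrow> 'm \<Rightarrow> 'm tvec set" where
  "tangent_subspace A T x = {v \<in> tangent_space A x.
     \<forall>f\<in>smooth_funs A. (\<exists>W. openin T W \<and> x \<in> W \<and> (\<forall>y\<in>W. f y = 0)) \<longrightarrow> v f = 0}"

definition nondegenerate_hypersurface ::
    "('m::topological_space, 'e::euclidean_space) chart set \<Rightarrow> 'm tensor2 \<Rightarrow> 'm topology \<Rightarrow> bool" where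
  "nondegenerate_hypersurface A g T \<longleftrightarrow>
     hypersurface A T \<and> (\<forall>x\<in>topspace T. nondegenerate_on (tangent_subspace A T x) (g x))"

definition extends_near ::
    "('m::topological_space, 'e::euclidean_space) chart set \<Rightarrow> 'm topology
       \<Rightarrow> 'm vfield \<Rightarrow> 'm \<Rightarrow> 'm vfield \<Rightarrow> bool" where
  "extends_near A T V x V' \<longleftrightarrow>
     V' \<in> vector_fields A \<and> (\<exists>W. openin T W \<and> x \<in> W \<and> (\<forall>y\<in>W. V' y = V y))"

text \<open>
  A vector field along \<open>M'\<close> (a section of \<open>TM\<close> over \<open>M'\<close>) is smooth if near every point of \<open>M'\<close> it
  is the restriction of a smooth vector field on \<open>M\<close>. Its values outside \<open>M'\<close> are irrelevant.
\<close>

definition vector_field_along ::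
    "('m::topological_space, 'e::euclidean_space) chart set \<Rightarrow> 'm topology \<Rightarrow> 'm vfield \<Rightarrow> bool" where
  "vector_field_along A T V \<longleftrightarrow> (\<forall>x\<in>topspace T. \<exists>V'. extends_near A T V x V')"

definition unit_normal ::
    "('m::topological_space, 'e::euclidean_space) chart set \<Rightarrow> 'm tensor2 \<Rightarrow> 'm topology
       \<Rightarrow> real \<Rightarrow> 'm vfield \<Rightarrow> bool" where
  "unit_normal A g T \<epsilon> N \<longleftrightarrow>
     (\<epsilon> = 1 \<or> \<epsilon> = -1) \<and> vector_field_along A T N \<and>
     (\<forall>x\<in>topspace T. g x (N x) (N x) = \<epsilon> \<and> (\<forall>v\<in>tangent_subspace A T x. g x (N x) v = 0))"

text \<open>
  \<open>\<nabla>\<^sub>u V\<close> for \<open>u\<close> tangent to \<open>M'\<close> at \<open>x\<close> and \<open>V\<close> a vector field along \<open>M'\<close>: \<open>w\<close> is the common value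
  at \<open>x\<close> of \<open>\<nabla>\<^sub>X V'\<close> over all vector fields \<open>X\<close>, \<open>V'\<close> on \<open>M\<close> with \<open>X x = u\<close> and \<open>V'\<close> extending \<open>V\<close>
  near \<open>x\<close>. For smooth \<open>V\<close> there is exactly one such \<open>w\<close>.
\<close>

definition has_cov_deriv_along ::
    "('m::topological_space, 'e::euclidean_space) chart set
       \<Rightarrow> ('m vfield \<Rightarrow> 'm vfield \<Rightarrow> 'm vfield) \<Rightarrow> 'm topology
       \<Rightarrow> 'm vfield \<Rightarrow> 'm \<Rightarrow> 'm tvec \<Rightarrow> 'm tvec \<Rightarrow> bool" where
  "has_cov_deriv_along A nabla T V x u w \<longleftrightarrow>
     {nabla X V' x | X V'. X \<in> vector_fields A \<and> X x = u \<and> extends_near A T V x V'} = {w}"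

text \<open>\<open>r = \<beta>\<^sub>x(u, v) = - g(\<nabla>\<^sub>u N, v)\<close>\<close>

definition has_beta ::
    "('m::topological_space, 'e::euclidean_space) chart set \<Rightarrow> 'm tensor2
       \<Rightarrow> ('m vfield \<Rightarrow> 'm vfield \<Rightarrow> 'm vfield) \<Rightarrow> 'm topology
       \<Rightarrow> 'm vfield \<Rightarrow> 'm \<Rightarrow> 'm tvec \<Rightarrow> 'm tvec \<Rightarrow> real \<Rightarrow> bool" where
  "has_beta A g nabla T N x u v r \<longleftrightarrow>
     (\<exists>w. has_cov_deriv_along A nabla T N x u w \<and> r = - g x w v)"

definition umbilical_point ::
    "('m::topological_space, 'e::euclidean_space) chart set \<Rightarrow> 'm tensor2
       \<Rightarrow> ('m vfield \<Rightarrow> 'm vfield \<Rightarrow> 'm vfield) \<Rightarrow> 'm topology \<Rightarrow> 'm vfield \<Rightarrow> 'm \<Rightarrow> bool" where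
  "umbilical_point A g nabla T N x \<longleftrightarrow>
     x \<in> topspace T \<and>
     (\<exists>c. \<forall>u\<in>tangent_subspace A T x. \<forall>v\<in>tangent_subspace A T x.
        has_beta A g nabla T N x u v (c * g x u v))"


section \<open>Conformal-projective change\<close>

definition gradient ::
    "('m::topological_space, 'e::euclidean_space) chart set \<Rightarrow> 'm tensor2 \<Rightarrow> ('m \<Rightarrow> real) \<Rightarrow> 'm vfield" where
  "gradient A g \<psi> p =
     (THE w. w \<in> tangent_space A p \<and> (\<forall>v\<in>tangent_space A p. g p w v = v \<psi>))"

definition cp_metric ::
    "'m tensor2 \<Rightarrow> ('m \<Rightarrow> real) \<Rightarrow> ('m \<Rightarrow> real) \<Rightarrow> 'm tensor2" where
  "cp_metric g \<phi> \<psi> = (\<lambda>p u v. exp (\<phi> p + \<psi> p) * g p u v)"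

definition cp_connection ::
    "('m::topological_space, 'e::euclidean_space) chart set \<Rightarrow> 'm tensor2
       \<Rightarrow> ('m vfield \<Rightarrow> 'm vfield \<Rightarrow> 'm vfield) \<Rightarrow> ('m \<Rightarrow> real) \<Rightarrow> ('m \<Rightarrow> real)
       \<Rightarrow> 'm vfield \<Rightarrow> 'm vfield \<Rightarrow> 'm vfield" where
  "cp_connection A g nabla \<phi> \<psi> X Y = (\<lambda>p h.
     nabla X Y p h + X p \<phi> * Y p h + Y p \<phi> * X p h - g p (X p) (Y p) * gradient A g \<psi> p h)"

definition cp_normal ::
    "('m \<Rightarrow> real) \<Rightarrow> ('m \<Rightarrow> real) \<Rightarrow> 'm vfield \<Rightarrow> 'm vfield" where
  "cp_normal \<phi> \<psi> N = vf_scale (\<lambda>p. exp (- (\<phi> p + \<psi> p) / 2)) N"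

end

theory Submission
  imports Defs
begin

text \<open>
  Put \<open>s = e\<^bsup>-(\<phi>+\<psi>)/2\<^esup>\<close>. For \<open>u\<close> tangent to \<open>M'\<close> the gradient term of the new connection
  disappears because \<open>g(u, N) = 0\<close>, and the Leibniz rule shows that the new derivative of \<open>s N\<close>
  along \<open>u\<close> equals \<open>s \<nabla>\<^sub>u N + s d\<phi>(N) u\<close> up to a multiple of \<open>N\<close>. Pairing with tangent vectors kills
  that multiple, so \<open>\<beta>\<close> is multiplied by \<open>s e\<^bsup>\<phi>+\<psi>\<^esup>\<close> and shifted by a multiple of \<open>g\<close>.
\<close>

section \<open>Smooth functions\<close>

text \<open>A Frechet derivative at \<open>x\<close> depends only on values near \<open>x\<close>,
  and an open \<open>S\<close> contains such a neighbourhood. So agreement on \<open>S\<close>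
  passes to the partial derivatives, and induction on the order applies to them.\<close>

lemma Ck_on_cong:
  assumes "open S" "\<And>x. x \<in> S \<Longrightarrow> f x = h x" "Ck_on k S f"
  shows "Ck_on k S h"
  using assms(2,3)
proof (induction k arbitrary: f h)
  case 0
  then show ?case by (auto cong: continuous_on_cong)
next
  case (Suc k)
  have D: "(h has_derivative frechet_derivative f (at x)) (at x)" if "x \<in> S" for x
    using has_derivative_transform_within_open[OF _ assms(1) that Suc.prems(1)] Suc.prems(2) that
    by (simp add: frechet_derivative_works)
  have "Ck_on k S (\<lambda>x. frechet_derivative h (at x) b)" if "b \<in> Basis" for b
  proof (rule Suc.IH)
    show "frechet_derivative f (at x) b = frechet_derivative h (at x) b" if "x \<in> S" for x
      using frechet_derivative_at[OF D[OF that]] by simp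
    show "Ck_on k S (\<lambda>x. frechet_derivative f (at x) b)"
      using Suc.prems(2) \<open>b \<in> Basis\<close> by simp
  qed
  with D show ?case
    by (auto simp: differentiable_def)
qed

lemma Ck_on_SucD: "Ck_on (Suc k) S f \<Longrightarrow> Ck_on k S f"
proof (induction k arbitrary: f)
  case 0
  then show ?case
    by (auto intro!: continuous_at_imp_continuous_on differentiable_imp_continuous_within)
next
  case (Suc k)
  then show ?case by (metis Ck_on.simps(2))
qed

text \<open>Lets a derivative produced by the calculus rules stand in for
  \<open>frechet_derivative\<close>: derivatives are unique, so the two agree at every point of
  \<open>S\<close>.\<close>

lemma Ck_on_SucI:
  assumes "open S" "\<And>x. x \<in> S \<Longrightarrow> (f has_derivative f' x) (at x)"
    and "\<And>b. b \<in> Basis \<Longrightarrow> Ck_on k S (\<lambda>x. f' x b)"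
  shows "Ck_on (Suc k) S f"
proof -
  have "f' x = frechet_derivative f (at x)" if "x \<in> S" for x
    using frechet_derivative_at[OF assms(2)[OF that]] .
  then have "Ck_on k S (\<lambda>x. frechet_derivative f (at x) b)" if "b \<in> Basis" for b
    using Ck_on_cong[OF assms(1) _ assms(3)[OF that]] by simp
  with assms(2) show ?thesis
    by (auto simp: differentiable_def)
qed

lemma Ck_on_const: "open S \<Longrightarrow> Ck_on k S (\<lambda>x. a)"
proof (induction k arbitrary: a)
  case (Suc k)
  show ?case
    by (rule Ck_on_SucI[OF Suc.prems has_derivative_const]) (rule Suc.IH[OF Suc.prems])
qed simp

lemma Ck_on_add: "open S \<Longrightarrow> Ck_on k S f \<Longrightarrow> Ck_on k S h \<Longrightarrow> Ck_on k S (\<lambda>x. f x + h x)"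
proof (induction k arbitrary: f h)
  case 0
  then show ?case by (simp add: continuous_on_add)
next
  case (Suc k)
  show ?case
  proof (rule Ck_on_SucI[OF \<open>open S\<close>])
    show "((\<lambda>x. f x + h x) has_derivative
        (\<lambda>b. frechet_derivative f (at x) b + frechet_derivative h (at x) b)) (at x)"
      if "x \<in> S" for x
      using Suc.prems that by (auto intro!: has_derivative_add simp: frechet_derivative_works)
    show "Ck_on k S (\<lambda>x. frechet_derivative f (at x) b + frechet_derivative h (at x) b)"
      if "b \<in> Basis" for b
      using Suc.prems that by (intro Suc.IH) simp_all
  qed
qed

lemma Ck_on_mult:
  fixes f h :: "'e::euclidean_space \<Rightarrow> 'b::real_normed_algebra"
  shows "open S \<Longrightarrow> Ck_on k S f \<Longrightarrow> Ck_on k S h \<Longrightarrow> Ck_on k S (\<lambda>x. f x * h x)"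
proof (induction k arbitrary: f h)
  case 0
  then show ?case by (simp add: continuous_on_mult)
next
  case (Suc k)
  show ?case
  proof (rule Ck_on_SucI[OF \<open>open S\<close>])
    show "((\<lambda>x. f x * h x) has_derivative
        (\<lambda>b. f x * frechet_derivative h (at x) b + frechet_derivative f (at x) b * h x)) (at x)"
      if "x \<in> S" for x
      using Suc.prems that by (auto intro!: has_derivative_mult simp: frechet_derivative_works)
    show "Ck_on k S (\<lambda>x. f x * frechet_derivative h (at x) b + frechet_derivative f (at x) b * h x)"
      if "b \<in> Basis" for b
      \<comment> \<open>The Leibniz rule keeps one factor undifferentiated; its order is lowered
        from \<open>Suc k\<close> to \<open>k\<close> to fit the induction hypothesis.\<close>
      using Suc.prems that Suc.prems(2,3)[THEN Ck_on_SucD]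
      by (intro Ck_on_add Suc.IH) simp_all
  qed
qed

lemma Ck_on_exp:
  fixes f :: "'e::euclidean_space \<Rightarrow> real"
  shows "open S \<Longrightarrow> Ck_on k S f \<Longrightarrow> Ck_on k S (\<lambda>x. exp (f x))"
proof (induction k)
  case 0
  then show ?case by (simp add: continuous_on_exp)
next
  case (Suc k)
  show ?case
  proof (rule Ck_on_SucI[OF \<open>open S\<close>])
    show "((\<lambda>x. exp (f x)) has_derivative
        (\<lambda>b. exp (f x) * frechet_derivative f (at x) b)) (at x)" if "x \<in> S" for x
      using Suc.prems that has_derivative_exp[of f "frechet_derivative f (at x)" x UNIV]
      by (simp add: frechet_derivative_works mult.commute)
    \<comment> \<open>The derivative reproduces \<open>exp (f x)\<close>, so the induction
      hypothesis is used for the same \<open>f\<close>, one order lower.\<close>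
    show "Ck_on k S (\<lambda>x. exp (f x) * frechet_derivative f (at x) b)" if "b \<in> Basis" for b
      using Suc.prems that Suc.prems(2)[THEN Ck_on_SucD]
      by (intro Ck_on_mult Suc.IH) simp_all
  qed
qed

section \<open>Smooth functions on the manifold, read in charts\<close>

lemma smooth_structure_open_image:
  "smooth_structure A \<Longrightarrow> (U, c) \<in> A \<Longrightarrow> open (c ` U)"
  by (auto simp: smooth_structure_def is_chart_def)

lemma smooth_funs_const: "smooth_structure A \<Longrightarrow> (\<lambda>p. a) \<in> smooth_funs A"
  by (auto simp: smooth_funs_def smooth_on_def o_def
      intro!: Ck_on_const dest: smooth_structure_open_image)

lemma smooth_funs_add:
  "smooth_structure A \<Longrightarrow> f \<in> smooth_funs A \<Longrightarrow> h \<in> smooth_funs A \<Longrightarrow>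
    (\<lambda>p. f p + h p) \<in> smooth_funs A"
  by (fastforce simp: smooth_funs_def smooth_on_def o_def
      intro!: Ck_on_add dest: smooth_structure_open_image)

lemma smooth_funs_mult:
  "smooth_structure A \<Longrightarrow> f \<in> smooth_funs A \<Longrightarrow> h \<in> smooth_funs A \<Longrightarrow>
    (\<lambda>p. f p * h p) \<in> smooth_funs A"
  by (fastforce simp: smooth_funs_def smooth_on_def o_def
      intro!: Ck_on_mult dest: smooth_structure_open_image)

lemma smooth_funs_exp:
  "smooth_structure A \<Longrightarrow> f \<in> smooth_funs A \<Longrightarrow> (\<lambda>p. exp (f p)) \<in> smooth_funs A"
  by (fastforce simp: smooth_funs_def smooth_on_def o_def
      intro!: Ck_on_exp dest: smooth_structure_open_image)


section \<open>Tangent vectors and vector fields\<close>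

lemma tangent_space_lincomb:
  "u \<in> tangent_space A p \<Longrightarrow> v \<in> tangent_space A p \<Longrightarrow>
    tv_add (tv_scale a u) (tv_scale b v) \<in> tangent_space A p"
  by (auto simp: tangent_space_def tv_add_def tv_scale_def algebra_simps)

lemma tangent_space_scale: "u \<in> tangent_space A p \<Longrightarrow> tv_scale a u \<in> tangent_space A p"
  using tangent_space_lincomb[of u A p u a 0] by (simp add: tv_add_def tv_scale_def)

lemma vector_fields_scale:
  assumes "smooth_structure A" "f \<in> smooth_funs A" "X \<in> vector_fields A"
  shows "vf_scale f X \<in> vector_fields A"
proof -
  have "vf_scale f X p \<in> tangent_space A p" for p
    using assms(3) by (auto simp: vector_fields_def vf_scale_def intro: tangent_space_scale)
  then show ?thesis
    using assms(3) smooth_funs_mult[OF assms(1,2)]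
    by (auto simp: vector_fields_def vf_scale_def tv_scale_def)
qed

text \<open>Fits the shape of the derivative in \<open>has_cov_deriv_along_cp\<close>, a combination
  of three tangent vectors written as a plain function on smooth functions.\<close>

lemma metric_lincomb3_left:
  assumes g: "pseudo_riemannian_metric A g"
    and uvw: "u \<in> tangent_space A p" "v \<in> tangent_space A p" "w \<in> tangent_space A p"
    and z: "z \<in> tangent_space A p"
  shows "g p (\<lambda>h. a * u h + b * v h + c * w h) z = a * g p u z + b * g p v z + c * g p w z"
proof -
  have lin: "g p (tv_add (tv_scale a u) (tv_scale b v)) z = a * g p u z + b * g p v z"
    if "u \<in> tangent_space A p" "v \<in> tangent_space A p" for u v a b
    using g that z by (auto simp: pseudo_riemannian_metric_def)
  \<comment> \<open>The factor 1 gives the inner sum the form required by two-term linearity, which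
    is then applied twice.\<close>
  have "(\<lambda>h. a * u h + b * v h + c * w h) =
      tv_add (tv_scale 1 (tv_add (tv_scale a u) (tv_scale b v))) (tv_scale c w)"
    by (simp add: tv_add_def tv_scale_def)
  then show ?thesis
    using lin[OF tangent_space_lincomb[OF uvw(1,2)] uvw(3), of 1 a b c] lin[OF uvw(1,2)] by simp
qed

section \<open>Covariant derivatives along the hypersurface\<close>

lemma extends_near_scale:
  assumes "smooth_structure A" "f \<in> smooth_funs A" "extends_near A T V x V'"
  shows "extends_near A T (vf_scale f V) x (vf_scale f V')"
  using assms vector_fields_scale by (auto simp: extends_near_def vf_scale_def)

text \<open>A set equals \<open>{w}\<close> iff it is inhabited and all its members are
  \<open>w\<close>: this separates existence of extensions from independence of their
  choice.\<close>

lemma has_cov_deriv_along_iff: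
  "has_cov_deriv_along A nabla T V x u w \<longleftrightarrow>
    (\<exists>X V'. X \<in> vector_fields A \<and> X x = u \<and> extends_near A T V x V') \<and>
    (\<forall>X V'. X \<in> vector_fields A \<and> X x = u \<and> extends_near A T V x V' \<longrightarrow> nabla X V' x = w)"
  unfolding has_cov_deriv_along_def by blast

lemma has_cov_deriv_along_tangent:
  assumes "affine_connection A nabla" "has_cov_deriv_along A nabla T V x u w"
  shows "w \<in> tangent_space A x"
proof -
  obtain X V' where "X \<in> vector_fields A" "extends_near A T V x V'" "nabla X V' x = w"
    using assms(2) by (auto simp: has_cov_deriv_along_iff)
  then show ?thesis
    using assms(1) by (auto simp: affine_connection_def extends_near_def vector_fields_def)
qed

lemma unit_normal_tangent_space:
  assumes "unit_normal A g T \<epsilon> N" "x \<in> topspace T"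
  shows "N x \<in> tangent_space A x"
proof -
  obtain V' where "extends_near A T N x V'"
    using assms by (auto simp: unit_normal_def vector_field_along_def)
  then show ?thesis
    by (auto simp: extends_near_def vector_fields_def dest: spec[of _ x])
qed

lemma extends_near_eq: "extends_near A T V x V' \<Longrightarrow> V' x = V x"
  by (auto simp: extends_near_def)

text \<open>Since \<open>s\<close> has a smooth inverse, the extensions of \<open>s N\<close> are
  exactly \<open>s\<close> times the extensions of \<open>N\<close>. The gradient enters only with
  the coefficient \<open>g x u (s N)\<close>, which \<open>orth\<close> makes zero, so its value
  never has to be determined.\<close>

lemma has_cov_deriv_along_cp:
  fixes A :: "('m::{t2_space, second_countable_topology}, 'e::euclidean_space) chart set"
  assumes A: "smooth_structure A" and nabla: "affine_connection A nabla"
    and s: "s \<in> smooth_funs A" "(\<lambda>p. inverse (s p)) \<in> smooth_funs A" "\<And>p. s p \<noteq> 0"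
    and orth: "g x u (tv_scale (s x) (N x)) = 0"
    and w: "has_cov_deriv_along A nabla T N x u w"
  shows "has_cov_deriv_along A (cp_connection A g nabla \<phi> \<psi>) T (vf_scale s N) x u
    (\<lambda>h. s x * w h + (u s + s x * u \<phi>) * N x h + s x * N x \<phi> * u h)"
  unfolding has_cov_deriv_along_iff
proof (intro conjI allI impI)
  show "\<exists>X V'. X \<in> vector_fields A \<and> X x = u \<and> extends_near A T (vf_scale s N) x V'"
    using w extends_near_scale[OF A s(1)] unfolding has_cov_deriv_along_iff by blast
  fix X V assume "X \<in> vector_fields A \<and> X x = u \<and> extends_near A T (vf_scale s N) x V"
  then have X: "X \<in> vector_fields A" "X x = u" and V: "extends_near A T (vf_scale s N) x V"
    by auto
  \<comment> \<open>Dividing an arbitrary extension of \<open>s N\<close> by \<open>s\<close> gives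
    an extension of \<open>N\<close>, to which the hypothesis on \<open>w\<close> applies.\<close>
  define V' where "V' = vf_scale (\<lambda>p. inverse (s p)) V"
  have "vf_scale (\<lambda>p. inverse (s p)) (vf_scale s N) = N"
    using s(3) by (auto simp: vf_scale_def tv_scale_def fun_eq_iff)
  then have V': "extends_near A T N x V'"
    using extends_near_scale[OF A s(2) V] by (simp add: V'_def)
  have V_eq: "V = vf_scale s V'"
    using s(3) by (auto simp: V'_def vf_scale_def tv_scale_def fun_eq_iff mult.assoc[symmetric])
  have "nabla X V = vf_add (vf_scale s (nabla X V')) (vf_scale (\<lambda>p. X p s) V')"
    using nabla s(1) X V' unfolding V_eq by (auto simp: affine_connection_def extends_near_def)
  moreover have "nabla X V' x = w"
    using w X V' by (auto simp: has_cov_deriv_along_iff)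
  ultimately have nabla_V: "nabla X V x h = s x * w h + u s * N x h" for h
    using X(2) extends_near_eq[OF V'] by (simp add: vf_add_def vf_scale_def tv_add_def tv_scale_def)
  have "V x = tv_scale (s x) (N x)"
    using extends_near_eq[OF V] by (simp add: vf_scale_def)
  \<comment> \<open>The second fact serves twice: for arbitrary \<open>h\<close> in the term with
    \<open>u \<phi>\<close>, and at \<open>h = \<phi>\<close> to turn \<open>V x \<phi>\<close> into
    \<open>s x * N x \<phi>\<close>.\<close>
  then have "g x (X x) (V x) = 0" "\<And>h. V x h = s x * N x h"
    using X(2) orth by (simp_all add: tv_scale_def)
  with nabla_V show "cp_connection A g nabla \<phi> \<psi> X V x =
      (\<lambda>h. s x * w h + (u s + s x * u \<phi>) * N x h + s x * N x \<phi> * u h)"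
    using X(2) by (intro ext) (simp add: cp_connection_def algebra_simps)
qed

theorem proposition4p8:
  fixes A :: "('m::{t2_space, second_countable_topology}, 'e::euclidean_space) chart set"
    and g :: "'m tensor2"
    and \<eta> :: "'m \<Rightarrow> 'm tvec \<Rightarrow> real"
    and nabla :: "'m vfield \<Rightarrow> 'm vfield \<Rightarrow> 'm vfield"
    and T :: "'m topology"
    and N :: "'m vfield"
    and \<epsilon> :: real
    and \<phi> \<psi> :: "'m \<Rightarrow> real"
    and x :: 'm
  assumes "SWMT A g \<eta> nabla"
    and "nondegenerate_hypersurface A g T"
    and "unit_normal A g T \<epsilon> N"
    and "\<phi> \<in> smooth_funs A" and "\<psi> \<in> smooth_funs A"
    and "umbilical_point A g nabla T N x"
  shows "umbilical_point A (cp_metric g \<phi> \<psi>) (cp_connection A g nabla \<phi> \<psi>) T (cp_normal \<phi> \<psi> N) x"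
proof -
  have A: "smooth_structure A" and g: "pseudo_riemannian_metric A g"
    and nabla: "affine_connection A nabla"
    using assms(1) by (auto simp: SWMT_def)
  obtain c where x: "x \<in> topspace T"
    and c: "\<And>u v. u \<in> tangent_subspace A T x \<Longrightarrow> v \<in> tangent_subspace A T x \<Longrightarrow>
      has_beta A g nabla T N x u v (c * g x u v)"
    using assms(6) by (auto simp: umbilical_point_def)
  have N: "N x \<in> tangent_space A x"
    by (rule unit_normal_tangent_space[OF assms(3) x])
  have normal: "g x (N x) v = 0" if "v \<in> tangent_subspace A T x" for v
    using assms(3) x that by (auto simp: unit_normal_def)
  have sub: "u \<in> tangent_space A x" if "u \<in> tangent_subspace A T x" for u
    using that by (simp add: tangent_subspace_def)
  have sym: "g x u v = g x v u" if "u \<in> tangent_space A x" "v \<in> tangent_space A x" for u v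
    using g that by (auto simp: pseudo_riemannian_metric_def)
  define s where "s = (\<lambda>p. exp (- (\<phi> p + \<psi> p) / 2))"
  \<comment> \<open>With the exponents of \<open>s\<close> and its inverse written as constant
    multiples of \<open>\<phi> + \<psi>\<close>, the single fact \<open>sum\<close> yields
    smoothness of both.\<close>
  have s_eq: "s p = exp (- 1 / 2 * (\<phi> p + \<psi> p))" for p
    by (simp add: s_def field_simps)
  have inverse_s_eq: "inverse (s p) = exp (1 / 2 * (\<phi> p + \<psi> p))" for p
    unfolding s_eq exp_minus[symmetric] by (simp add: field_simps)
  have sum: "(\<lambda>p. a * (\<phi> p + \<psi> p)) \<in> smooth_funs A" for a
    by (intro smooth_funs_mult smooth_funs_add smooth_funs_const A assms)
  have s: "s \<in> smooth_funs A"
    by (subst ext[of s, OF s_eq]) (rule smooth_funs_exp[OF A sum])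
  have s_inv: "(\<lambda>p. inverse (s p)) \<in> smooth_funs A"
    unfolding inverse_s_eq by (rule smooth_funs_exp[OF A sum])
  have cov: "has_cov_deriv_along A (cp_connection A g nabla \<phi> \<psi>) T (cp_normal \<phi> \<psi> N) x u
      (\<lambda>h. s x * w h + (u s + s x * u \<phi>) * N x h + s x * N x \<phi> * u h)"
    if u: "u \<in> tangent_subspace A T x" and w: "has_cov_deriv_along A nabla T N x u w" for u w
  proof -
    \<comment> \<open>Linearity is available in the first slot, so the scaled normal is treated
      there and moved to the second slot by symmetry. The zero coefficients reduce the three-term
      formula to homogeneity.\<close>
    have "g x (tv_scale (s x) (N x)) u = 0"
      using metric_lincomb3_left[OF g N N N sub[OF u], of "s x" 0 0] normal[OF u]
      by (simp add: tv_scale_def)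
    then have "g x u (tv_scale (s x) (N x)) = 0"
      using sym[OF sub[OF u] tangent_space_scale[OF N]] by simp
    then have "has_cov_deriv_along A (cp_connection A g nabla \<phi> \<psi>) T (vf_scale s N) x u
        (\<lambda>h. s x * w h + (u s + s x * u \<phi>) * N x h + s x * N x \<phi> * u h)"
      by (intro has_cov_deriv_along_cp A nabla s s_inv w) (simp_all add: s_def)
    then show ?thesis by (simp add: cp_normal_def s_def)
  qed
  \<comment> \<open>The new umbilicity constant is \<open>s x * (c - N x \<phi>)\<close>: scaling
    the normal contributes \<open>s x\<close>, and the term d\<phi>(N) u of the new connection
    shifts \<open>c\<close>. The conformal factor is absorbed by the new metric. The constant
    depends on neither \<open>u\<close> nor \<open>v\<close>.\<close>
  have "has_beta A (cp_metric g \<phi> \<psi>) (cp_connection A g nabla \<phi> \<psi>) T (cp_normal \<phi> \<psi> N) x u v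
      (s x * (c - N x \<phi>) * cp_metric g \<phi> \<psi> x u v)"
    if u: "u \<in> tangent_subspace A T x" and v: "v \<in> tangent_subspace A T x" for u v
  proof -
    obtain w where w: "has_cov_deriv_along A nabla T N x u w" "g x w v = - (c * g x u v)"
      using c[OF u v] by (fastforce simp: has_beta_def)
    \<comment> \<open>Both the derivative of \<open>s\<close> and the \<open>u \<phi>\<close> term
      multiply \<open>N x\<close>, so they vanish against the tangent vector
      \<open>v\<close>.\<close>
    have "g x (\<lambda>h. s x * w h + (u s + s x * u \<phi>) * N x h + s x * N x \<phi> * u h) v =
        s x * g x w v + s x * N x \<phi> * g x u v"
      using metric_lincomb3_left[OF g has_cov_deriv_along_tangent[OF nabla w(1)] N
          sub[OF u] sub[OF v]] normal[OF v] by simp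
    also have "\<dots> = - (s x * (c - N x \<phi>) * g x u v)"
      using w(2) by (simp add: algebra_simps)
    finally show ?thesis
      unfolding has_beta_def using cov[OF u w(1)]
      by (intro exI conjI) (auto simp: cp_metric_def)
  qed
  then show ?thesis
    using x by (auto simp: umbilical_point_def)
qed

end
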